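(* Let $G$ be a finite simple undirected graph such that every clique in $G^2$ is contained in a set of the form $N_G[v]$ for some vertex $v$ of $G$. Then the inclusion of simplicial complexes $\mathrm{Cl}(G)\hookrightarrow \mathrm{Cl}(G^2)$ is a homotopy equivalence.
   Context: All graphs are simple, finite and undirected. $G^r$ denotes the $r$-th distance power of $G$: the graph on the vertex set $V(G)$ in which two distinct vertices are adjacent iff their distance in $G$ is at most $r$. $N_G[v]=\{v\}\cup\{w: vw\in E(G)\}$ is the closed neighbourhood of $v$. The clique complex $\mathrm{Cl}(G)$ is the simplicial complex with vertex set $V(G)$ whose simplices are the cliques (sets of pairwise adjacent vertices) of $G$. Since $G$ is a subgraph of $G^2$, $\mathrm{Cl}(G)$ is a subcomplex of $\mathrm{Cl}(G^2)$. Simplicial complexes are identified with their geometric realizations. *)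

theory Defs
  imports "HOL-Analysis.Analysis" "Graph_Theory.Graph_Theory"
begin

section \<open>Distance powers and clique complexes of graphs\<close>

text \<open>
  A finite simple undirected graph is a \<^locale>\<open>pair_graph\<close>: finitely many vertices, and a finite
  symmetric loop-free arc relation, so that an edge is a pair of opposite arcs.
\<close>

definition graph_dist :: "'a pair_pre_digraph \<Rightarrow> 'a \<Rightarrow> 'a \<Rightarrow> ereal" where
  "graph_dist G u v = wf_digraph.\<mu> (with_proj G) (\<lambda>_. 1) u v"

definition graph_power :: "'a pair_pre_digraph \<Rightarrow> nat \<Rightarrow> 'a pair_pre_digraph" where
  "graph_power G r = \<lparr> pverts = pverts G,
     parcs = {(u, v). u \<in> pverts G \<and> v \<in> pverts G \<and> u \<noteq> v \<and> graph_dist G u v \<le> ereal (real r)} \<rparr>"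

definition closed_nbhd :: "'a pair_pre_digraph \<Rightarrow> 'a \<Rightarrow> 'a set" where
  "closed_nbhd G v = insert v {w. (v, w) \<in> parcs G}"

text \<open>
  Cliques are taken to be nonempty, since they serve as the simplices of the clique complex.
\<close>

definition clique :: "'a pair_pre_digraph \<Rightarrow> 'a set \<Rightarrow> bool" where
  "clique G S \<longleftrightarrow> S \<noteq> {} \<and> S \<subseteq> pverts G \<and> (\<forall>u\<in>S. \<forall>v\<in>S. u \<noteq> v \<longrightarrow> (u, v) \<in> parcs G)"

definition clique_complex :: "'a pair_pre_digraph \<Rightarrow> 'a set set" where
  "clique_complex G = {S. clique G S}"

lemma graph_dist_le_iff:
  assumes "pair_graph G"
  shows "graph_dist G u v \<le> ereal (real r) \<longleftrightarrow>
    (\<exists>p. pre_digraph.awalk (with_proj G) u p v \<and> length p \<le> r)"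
proof -
  interpret pair_graph G by fact
  let ?L = "\<lambda>p. ereal (awalk_cost (\<lambda>_. 1) p)"
  have cost: "?L p = ereal (real (length p))" for p :: "('a \<times> 'a) list"
    by (induction p) (auto simp: awalk_cost_def)
  have mu: "graph_dist G u v = (INF p\<in>{p. awalk u p v}. ?L p)"
    unfolding graph_dist_def \<mu>_def ..
  show ?thesis
  proof
    assume *: "graph_dist G u v \<le> ereal (real r)"
    also have "ereal (real r) < ereal (real r + 1)" by simp
    finally obtain p where "awalk u p v" "?L p < ereal (real r + 1)"
      unfolding mu by (auto simp: INF_less_iff)
    then show "\<exists>p. awalk u p v \<and> length p \<le> r"
      by (auto simp: cost intro!: exI[of _ p])
  next
    assume "\<exists>p. awalk u p v \<and> length p \<le> r"
    then show "graph_dist G u v \<le> ereal (real r)"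
      unfolding mu by (auto simp: cost intro!: INF_lower2)
  qed
qed

lemma pair_graph_graph_power:
  assumes "pair_graph G"
  shows "pair_graph (graph_power G r)"
proof -
  interpret pair_graph G by fact
  have sym: "graph_dist G v u \<le> ereal (real r)" if "graph_dist G u v \<le> ereal (real r)" for u v
  proof -
    from that obtain p where p: "awalk u p v" "length p \<le> r"
      using graph_dist_le_iff[OF assms] by blast
    moreover have "length (rev_path p) = length p" for p :: "('a \<times> 'a) list"
      by (induction p) auto
    ultimately have "awalk v (rev_path p) u" "length (rev_path p) \<le> r"
      by simp_all
    then show ?thesis using graph_dist_le_iff[OF assms] by blast
  qed
  have "finite (parcs (graph_power G r))"
    by (rule finite_subset[of _ "pverts G \<times> pverts G"])
       (auto simp: graph_power_def pair_finite_verts)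
  then show ?thesis
    by unfold_locales
       (auto simp: graph_power_def pair_finite_verts symmetric_def intro!: symI dest: sym)
qed

lemma clique_complex_subset_power:
  assumes "pair_graph G" "r \<ge> 1"
  shows "clique_complex G \<subseteq> clique_complex (graph_power G r)"
proof -
  interpret pair_graph G by fact
  have "(u, v) \<in> parcs (graph_power G r)" if "(u, v) \<in> parcs G" for u v
  proof -
    have "awalk u [(u, v)] v" using that by (auto simp: awalk_def in_arcsD1)
    then have "graph_dist G u v \<le> ereal (real r)"
      unfolding graph_dist_le_iff[OF assms(1)] using assms(2) by (intro exI[of _ "[(u, v)]"]) simp
    then show ?thesis using that pair_no_loops[OF that]
      by (simp add: graph_power_def in_arcsD1 in_arcsD2)
  qed
  moreover have "pverts (graph_power G r) = pverts G"
    by (simp add: graph_power_def)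
  ultimately show ?thesis
    unfolding clique_complex_def clique_def by (simp add: Collect_mono)
qed


section \<open>Geometric realization\<close>

text \<open>
  A finite abstract simplicial complex is given by its set of nonempty simplices.  Points of the
  realization are given by their barycentric coordinates, which vanish outside the vertices of
  some simplex.  The topology is the subspace topology of the product topology on
  \<^typ>\<open>'a \<Rightarrow> real\<close>; for a finite complex this is the usual topology of the realization as a
  subspace of a finite-dimensional Euclidean space.

  If \<^term>\<open>K\<close> is a subcomplex of \<^term>\<open>L\<close>, then the inclusion of simplicial complexes realizes to
  the map that keeps barycentric coordinates, i.e. the inclusion of sets of coordinate functions.
\<close>

definition realization_set :: "'a set set \<Rightarrow> ('a \<Rightarrow> real) set" where
  "realization_set K = {x. (\<forall>v. 0 \<le> x v) \<and> {v. x v \<noteq> 0} \<in> K \<and> (\<Sum>v | x v \<noteq> 0. x v) = 1}"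

definition geometric_realization :: "'a set set \<Rightarrow> ('a \<Rightarrow> real) topology" where
  "geometric_realization K = top_of_set (realization_set K)"

definition homotopy_equivalence_map :: "'a topology \<Rightarrow> 'b topology \<Rightarrow> ('a \<Rightarrow> 'b) \<Rightarrow> bool" where
  "homotopy_equivalence_map X Y f \<longleftrightarrow>
     continuous_map X Y f \<and>
     (\<exists>g. continuous_map Y X g \<and>
          homotopic_with (\<lambda>_. True) X X (g \<circ> f) id \<and>
          homotopic_with (\<lambda>_. True) Y Y (f \<circ> g) id)"

end

theory Submission
  imports Defs
begin

text \<open>
  Every point \<open>x\<close> of a realization is \<open>\<Sum>\<^sub>S w\<^sub>S(x) 1\<^sub>S\<close>, where \<open>w\<^sub>S(x)\<close> is the length of the interval of
  thresholds \<open>t\<close> with \<open>{v. x v > t} = S\<close>; the \<open>S\<close> of positive weight form a chain.  Replacing \<open>1\<^sub>S\<close> by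
  \<open>|S|\<close> times the unit mass at a vertex \<open>u S\<close> for all \<open>S\<close> outside \<open>Cl(G)\<close>, we obtain a map on
  \<open>Cl(G\<^sup>2)\<close> that fixes \<open>Cl(G)\<close> pointwise.  Let \<open>C(S)\<close> be the set of common closed neighbours of \<open>S\<close>.
  By hypothesis \<open>C(S) \<union> C(C(S))\<close>, a clique of \<open>G\<^sup>2\<close>, lies in some \<open>N[a]\<close>; then \<open>a\<close> belongs to \<open>C(C(S))\<close> and
  is a cone point for it, and we put \<open>u S = a\<close>.  Since \<open>S \<mapsto> C(C(S))\<close> is monotone and extensive, the
  images of points span cliques of \<open>G\<close>, and the straight-line homotopy to the identity stays in
  \<open>Cl(G\<^sup>2)\<close>.  So \<open>Cl(G)\<close> is a strong deformation retract.
\<close>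

section \<open>Decomposition of a nonnegative function into its superlevel sets\<close>

text \<open>A threshold \<open>t \<ge> 0\<close> cuts out \<open>S\<close> iff it is at least every
  value outside \<open>S\<close> and below every value on \<open>S\<close>. The inserted 0 starts
  the thresholds at 0 and covers \<open>S = V\<close>; the outer \<open>max\<close> handles an empty
  interval. Only nonempty \<open>S\<close> occur in the sums below, so \<open>Min\<close> is
  meaningful.\<close>

definition level_weight :: "'a set \<Rightarrow> ('a \<Rightarrow> real) \<Rightarrow> 'a set \<Rightarrow> real" where
  "level_weight V x S = max 0 (Min (x ` S) - Max (insert 0 (x ` (V - S))))"

lemma level_weight_nonneg: "0 \<le> level_weight V x S"
  by (simp add: level_weight_def)

lemma level_weight_posD:
  assumes "finite V" "S \<subseteq> V" "0 < level_weight V x S" "v \<in> S"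
  shows "0 < x v" and "w \<in> V - S \<Longrightarrow> x w < x v"
proof -
  have fin: "finite S" using assms by (blast intro: finite_subset)
  have "Max (insert 0 (x ` (V - S))) < Min (x ` S)"
    using assms(3) by (simp add: level_weight_def)
  also have "\<dots> \<le> x v" using fin assms(4) by simp
  finally have *: "Max (insert 0 (x ` (V - S))) < x v" .
  have "Max (insert 0 (x ` (V - S))) < x v \<longleftrightarrow> (\<forall>a\<in>insert 0 (x ` (V - S)). a < x v)"
    using assms(1) by (intro Max_less_iff) auto
  with * have "\<forall>a\<in>insert 0 (x ` (V - S)). a < x v" by blast
  then show "0 < x v" and "w \<in> V - S \<Longrightarrow> x w < x v"
    by auto
qed

text \<open>Superlevel sets of one function are nested: vertices \<open>a\<close> in
  \<open>S - T\<close> and \<open>b\<close> in \<open>T - S\<close> would each have the larger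
  value.\<close>

lemma level_weight_chain:
  assumes "finite V" "S \<subseteq> V" "T \<subseteq> V" "0 < level_weight V x S" "0 < level_weight V x T"
  shows "S \<subseteq> T \<or> T \<subseteq> S"
proof (rule ccontr)
  assume "\<not> (S \<subseteq> T \<or> T \<subseteq> S)"
  then obtain a b where "a \<in> S" "a \<in> V - T" "b \<in> T" "b \<in> V - S" using assms by blast
  then have "x b < x a" "x a < x b"
    using level_weight_posD(2)[OF assms(1,2,4)] level_weight_posD(2)[OF assms(1,3,5)] by blast+
  then show False by simp
qed

lemma level_weight_eq_0:
  assumes "finite V" "S \<subseteq> V" "a \<in> S" "b \<in> V - S" "x a \<le> x b"
  shows "level_weight V x S = 0"
  using level_weight_posD(2)[OF assms(1,2) _ assms(3,4), of x] level_weight_nonneg[of V x S] assms(5)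
  by force

text \<open>Subtracting \<open>x a\<close> turns the value at the deleted vertex into the base
  threshold 0, so both ends of the interval move by the same amount. This is the inductive step of
  the decomposition.\<close>

lemma level_weight_remove_Min:
  assumes "finite V" "a \<in> V" "0 \<le> x a" "S \<subseteq> V - {a}" "S \<noteq> {}"
  shows "level_weight V x S = level_weight (V - {a}) (\<lambda>v. x v - x a) S"
proof -
  have fin: "finite S" using assms finite_subset by fastforce
  let ?R = "V - {a} - S"
  have V: "V - S = insert a ?R" using assms by blast
  have "Min ((\<lambda>v. x v - x a) ` S) = Min ((\<lambda>r. r - x a) ` x ` S)"
    by (simp add: image_image)
  also have "\<dots> = Min (x ` S) - x a"
    using fin assms(5) by (intro mono_Min_commute[symmetric]) (auto simp: mono_def)
  finally have 1: "Min ((\<lambda>v. x v - x a) ` S) = Min (x ` S) - x a" .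
  have "Max (insert 0 ((\<lambda>v. x v - x a) ` ?R)) = Max ((\<lambda>r. r - x a) ` insert (x a) (x ` ?R))"
    by (simp add: image_image)
  also have "\<dots> = Max (insert (x a) (x ` ?R)) - x a"
    using assms(1) by (intro mono_Max_commute[symmetric]) (auto simp: mono_def)
  \<comment> \<open>The base threshold 0 is absorbed because \<open>x a\<close> is
    nonnegative.\<close>
  also have "Max (insert (x a) (x ` ?R)) = Max (insert 0 (insert (x a) (x ` ?R)))"
  proof -
    have "x a \<le> Max (insert (x a) (x ` ?R))" using assms(1) by (intro Max_ge) auto
    then have "0 \<le> Max (insert (x a) (x ` ?R))" using assms(3) by linarith
    then show ?thesis using assms(1) by (subst (2) Max_insert) auto
  qed
  finally have 2: "Max (insert 0 ((\<lambda>v. x v - x a) ` ?R)) = Max (insert 0 (x ` (V - S))) - x a"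
    by (simp add: V)
  show ?thesis unfolding level_weight_def 1 2 by simp
qed

text \<open>Layer-cake formula, by removing a minimizer \<open>a\<close>: \<open>V\<close> itself
  has weight \<open>x a\<close>, every other set containing \<open>a\<close> has weight 0, and the
  sets avoiding \<open>a\<close> decompose the function shifted by \<open>x a\<close>.\<close>

lemma sum_level_weight:
  assumes "finite V" "\<And>v. v \<in> V \<Longrightarrow> 0 \<le> x v" "v \<in> V"
  shows "(\<Sum>S | S \<subseteq> V \<and> v \<in> S. level_weight V x S) = x v"
  using assms
proof (induction V arbitrary: x v rule: finite_psubset_induct)
  case (psubset V)
  obtain a where a: "a \<in> V" "\<And>w. w \<in> V \<Longrightarrow> x a \<le> x w"
    using psubset.hyps psubset.prems(2) ex_is_arg_min_if_finite[of V x]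
    by (auto simp: is_arg_min_linorder)
  have fin: "finite {S. S \<subseteq> V \<and> v \<in> S}" using psubset.hyps by simp
  have top: "level_weight V x V = x a"
  proof -
    have "Min (x ` V) = x a" using a psubset.hyps by (intro Min_eqI) auto
    then show ?thesis using psubset.prems(1)[OF a(1)] by (simp add: level_weight_def)
  qed
  have "(\<Sum>S | S \<subseteq> V \<and> v \<in> S. level_weight V x S) =
      level_weight V x V + (\<Sum>S\<in>{S. S \<subseteq> V \<and> v \<in> S} - {V}. level_weight V x S)"
    using psubset.prems fin by (intro sum.remove) auto
  also have "(\<Sum>S\<in>{S. S \<subseteq> V \<and> v \<in> S} - {V}. level_weight V x S) =
      (\<Sum>S | S \<subseteq> V - {a} \<and> v \<in> S. level_weight V x S)"
  proof (rule sum.mono_neutral_right)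
    show "\<forall>S\<in>{S. S \<subseteq> V \<and> v \<in> S} - {V} - {S. S \<subseteq> V - {a} \<and> v \<in> S}. level_weight V x S = 0"
    proof
      fix S assume "S \<in> {S. S \<subseteq> V \<and> v \<in> S} - {V} - {S. S \<subseteq> V - {a} \<and> v \<in> S}"
      then obtain b where "S \<subseteq> V" "a \<in> S" "b \<in> V - S" by blast
      then show "level_weight V x S = 0"
        using a psubset.hyps by (intro level_weight_eq_0) auto
    qed
  qed (use fin a in auto)
  also have "\<dots> = (\<Sum>S | S \<subseteq> V - {a} \<and> v \<in> S. level_weight (V - {a}) (\<lambda>v. x v - x a) S)"
    using psubset.hyps a psubset.prems by (intro sum.cong level_weight_remove_Min) auto
  also have "\<dots> = x v - x a"
  \<comment> \<open>For \<open>v = a\<close> the sum is empty and the right-hand side is 0.\<close>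
  proof (cases "v = a")
    case False
    then show ?thesis using a psubset.prems by (intro psubset.IH) auto
  qed (auto intro: sum.neutral)
  finally show ?case by (simp add: top)
qed

section \<open>Continuity of the weights\<close>

lemma continuous_on_Min_image:
  fixes f :: "'i \<Rightarrow> 'x::topological_space \<Rightarrow> real"
  assumes "finite I" "I \<noteq> {}" "\<And>i. i \<in> I \<Longrightarrow> continuous_on A (f i)"
  shows "continuous_on A (\<lambda>x. Min ((\<lambda>i. f i x) ` I))"
  using assms by (induction I rule: finite_ne_induct) (auto intro!: continuous_intros)

lemma continuous_on_Max_insert_image:
  fixes f :: "'i \<Rightarrow> 'x::topological_space \<Rightarrow> real"
  assumes "finite I" "\<And>i. i \<in> I \<Longrightarrow> continuous_on A (f i)"
  shows "continuous_on A (\<lambda>x. Max (insert c ((\<lambda>i. f i x) ` I)))"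
  using assms
proof (induction I rule: finite_induct)
  case (insert i I)
  have "Max (insert c ((\<lambda>i. f i x) ` insert i I)) = max (f i x) (Max (insert c ((\<lambda>i. f i x) ` I)))" for x
    using insert.hyps Max_insert[of "insert c ((\<lambda>i. f i x) ` I)" "f i x"]
    by (simp only: image_insert insert_commute finite_imageI finite_insert) simp
  then show ?case using insert by (auto intro!: continuous_intros)
qed auto

lemma continuous_on_level_weight:
  assumes "finite V" "S \<subseteq> V" "S \<noteq> {}"
  shows "continuous_on A (\<lambda>x. level_weight V x S)"
  unfolding level_weight_def
  using assms finite_subset[OF assms(2,1)]
  by (intro continuous_intros continuous_on_Min_image continuous_on_Max_insert_image
      continuous_on_product_coordinates[THEN continuous_on_subset]) auto

section \<open>Retraction of a complex onto a subcomplex\<close>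

text \<open>The combinatorial input of the deformation. In \<open>chain_K\<close>, \<open>C\<close>
  stands for the superlevel sets outside \<open>K\<close> and \<open>S\<close> for the largest one
  inside; it puts the image of a point into \<open>K\<close>. \<open>below_L\<close> keeps the
  segment from a point to its image inside \<open>L\<close>.\<close>

locale retractable_pair =
  fixes V :: "'a set" and K L :: "'a set set" and u :: "'a set \<Rightarrow> 'a"
  assumes finite_V: "finite V"
    and L_subset: "S \<in> L \<Longrightarrow> S \<subseteq> V"
    and L_nonempty: "S \<in> L \<Longrightarrow> S \<noteq> {}"
    and L_down: "S \<in> L \<Longrightarrow> T \<subseteq> S \<Longrightarrow> T \<noteq> {} \<Longrightarrow> T \<in> L"
    and K_down: "S \<in> K \<Longrightarrow> T \<subseteq> S \<Longrightarrow> T \<noteq> {} \<Longrightarrow> T \<in> K"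
    and K_subset_L: "K \<subseteq> L"
    and chain_K: "C \<subseteq> L - K \<Longrightarrow> (\<And>T T'. T \<in> C \<Longrightarrow> T' \<in> C \<Longrightarrow> T \<subseteq> T' \<or> T' \<subseteq> T) \<Longrightarrow>
      S \<in> K \<or> S = {} \<Longrightarrow> (\<And>T. T \<in> C \<Longrightarrow> S \<subseteq> T) \<Longrightarrow> S \<union> u ` C \<noteq> {} \<Longrightarrow> S \<union> u ` C \<in> K"
    and below_L: "S \<in> L \<Longrightarrow> C \<subseteq> L - K \<Longrightarrow> (\<And>T. T \<in> C \<Longrightarrow> T \<subseteq> S) \<Longrightarrow> S \<union> u ` C \<in> L"
begin

definition retr :: "('a \<Rightarrow> real) \<Rightarrow> 'a \<Rightarrow> real" where
  "retr x v = (\<Sum>S\<in>L. level_weight V x S *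
     (if S \<in> K then indicator S v else if v = u S then real (card S) else 0))"

lemma finite_L: "finite L"
  using finite_V L_subset by (auto intro: finite_subset[of _ "Pow V"])

lemma retr_nonneg: "0 \<le> retr x v"
  unfolding retr_def by (intro sum_nonneg mult_nonneg_nonneg level_weight_nonneg) auto

lemma retr_nonzeroE:
  assumes "retr x v \<noteq> 0"
  obtains S where "S \<in> L" "0 < level_weight V x S" "S \<in> K \<Longrightarrow> v \<in> S" "S \<notin> K \<Longrightarrow> v = u S"
proof -
  obtain S where S: "S \<in> L" "level_weight V x S *
     (if S \<in> K then indicator S v else if v = u S then real (card S) else 0) \<noteq> 0"
    using assms unfolding retr_def by (rule sum.not_neutral_contains_not_neutral)
  show thesis
  proof
    show "0 < level_weight V x S"
      using S(2) level_weight_nonneg[of V x S] by (simp add: less_le)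
  qed (use S in \<open>auto simp: indicator_def split: if_splits\<close>)
qed

lemma level_weight_subset_support:
  "S \<in> L \<Longrightarrow> 0 < level_weight V x S \<Longrightarrow> S \<subseteq> {v. x v \<noteq> 0}"
  using level_weight_posD(1)[OF finite_V L_subset] by fastforce

lemma support_subset: "x \<in> realization_set L \<Longrightarrow> {v. x v \<noteq> 0} \<subseteq> V"
  using L_subset unfolding realization_set_def by blast

lemma realization_sum_V: "x \<in> realization_set L \<Longrightarrow> (\<Sum>v\<in>V. x v) = 1"
  using support_subset[of x] finite_V
  by (subst sum.mono_neutral_right[of V "{v. x v \<noteq> 0}"]) (auto simp: realization_set_def)

text \<open>Restricting the layer-cake sum to \<open>L\<close> loses nothing: a set of positive
  weight containing \<open>v\<close> is a nonempty subset of the support, hence a simplex of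
  \<open>L\<close>.\<close>

lemma sum_level_weight_L:
  assumes x: "x \<in> realization_set L"
  shows "(\<Sum>S\<in>L. level_weight V x S * indicator S v) = x v"
proof (cases "v \<in> V")
  case True
  have supp: "{v. x v \<noteq> 0} \<in> L" and nn: "\<And>v. 0 \<le> x v" using x by (auto simp: realization_set_def)
  have "(\<Sum>S\<in>L. level_weight V x S * indicator S v) = (\<Sum>S | S \<in> L \<and> v \<in> S. level_weight V x S)"
    using finite_L by (intro sum.mono_neutral_cong_right) (auto simp: indicator_def)
  also have "\<dots> = (\<Sum>S | S \<subseteq> V \<and> v \<in> S. level_weight V x S)"
  proof (rule sum.mono_neutral_left)
    show "\<forall>S\<in>{S. S \<subseteq> V \<and> v \<in> S} - {S. S \<in> L \<and> v \<in> S}. level_weight V x S = 0"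
    proof (rule ballI, rule ccontr)
      fix S assume S: "S \<in> {S. S \<subseteq> V \<and> v \<in> S} - {S. S \<in> L \<and> v \<in> S}" "level_weight V x S \<noteq> 0"
      then have "0 < level_weight V x S" using level_weight_nonneg[of V x S] by simp
      then have "S \<subseteq> {v. x v \<noteq> 0}" using level_weight_posD(1)[OF finite_V, of S x] S(1) by fastforce
      then have "S \<in> L" using L_down[OF supp] S(1) by blast
      then show False using S(1) by blast
    qed
  qed (use L_subset finite_V in auto)
  also have "\<dots> = x v" using finite_V nn True by (intro sum_level_weight)
  finally show ?thesis .
next
  case False
  then have "x v = 0" using support_subset[OF x] by blast
  moreover have "(\<Sum>S\<in>L. level_weight V x S * indicator S v) = 0"
    using L_subset False by (intro sum.neutral) (auto simp: indicator_def)
  ultimately show ?thesis by simp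
qed

text \<open>Simplices of positive weight lie in the support of \<open>x\<close>, hence in
  \<open>K\<close>, so \<open>u\<close> never enters and the sum is the level decomposition of
  \<open>x\<close>.\<close>

lemma retr_eq:
  assumes x: "x \<in> realization_set K"
  shows "retr x = x"
proof
  fix v
  have xL: "x \<in> realization_set L" and supp: "{v. x v \<noteq> 0} \<in> K"
    using x K_subset_L by (auto simp: realization_set_def)
  have "S \<in> K" if "S \<in> L" "level_weight V x S \<noteq> 0" for S
    using that level_weight_subset_support[of S x] level_weight_nonneg[of V x S]
      K_down[OF supp] L_nonempty by (simp add: less_le)
  then have "retr x v = (\<Sum>S\<in>L. level_weight V x S * indicator S v)"
    unfolding retr_def by (intro sum.cong) auto
  then show "retr x v = x v" using sum_level_weight_L[OF xL] by simp
qed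

lemma u_in_V: "S \<in> L - K \<Longrightarrow> u S \<in> V"
  using below_L[of S "{S}"] L_subset by blast

text \<open>Mass is preserved simplex by simplex: \<open>card S\<close> units at \<open>u S\<close>,
  a vertex of \<open>V\<close>, replace one unit at each vertex of \<open>S\<close>.\<close>

lemma sum_retr:
  assumes x: "x \<in> realization_set L"
  shows "(\<Sum>v\<in>V. retr x v) = 1"
proof -
  have "(\<Sum>v\<in>V. retr x v) = (\<Sum>S\<in>L. \<Sum>v\<in>V. level_weight V x S *
     (if S \<in> K then indicator S v else if v = u S then real (card S) else 0))"
    unfolding retr_def by (rule sum.swap)
  also have "\<dots> = (\<Sum>S\<in>L. \<Sum>v\<in>V. level_weight V x S * indicator S v)"
  proof (rule sum.cong[OF refl])
    fix S assume S: "S \<in> L"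
    have "(\<Sum>v\<in>V. if v = u S then real (card S) else 0) = (\<Sum>v\<in>V. indicator S v)" if "S \<notin> K"
      using that S u_in_V[of S] L_subset[OF S] finite_V
      by (simp add: indicator_def sum.If_cases Int_absorb1)
    then show "(\<Sum>v\<in>V. level_weight V x S *
         (if S \<in> K then indicator S v else if v = u S then real (card S) else 0)) =
       (\<Sum>v\<in>V. level_weight V x S * indicator S v)"
      by (cases "S \<in> K") (simp_all flip: sum_distrib_left)
  qed
  also have "\<dots> = (\<Sum>v\<in>V. x v)"
    by (subst sum.swap) (simp add: sum_level_weight_L[OF x])
  finally show ?thesis using realization_sum_V[OF x] by simp
qed

text \<open>The simplices of positive weight form a chain, split into those in \<open>K\<close>,
  with union \<open>S\<close>, and the rest \<open>C\<close>. Then \<open>chain_K\<close> gives the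
  first claim, and \<open>below_L\<close>, applied to the support of \<open>x\<close>, the
  second.\<close>

lemma retr_support:
  assumes x: "x \<in> realization_set L"
  shows "{v. retr x v \<noteq> 0} \<in> K" and "{v. x v \<noteq> 0} \<union> {v. retr x v \<noteq> 0} \<in> L"
proof -
  let ?P = "{S \<in> L. 0 < level_weight V x S}"
  define S where "S = \<Union>(?P \<inter> K)"
  define C where "C = ?P - K"
  have chain: "T \<subseteq> T' \<or> T' \<subseteq> T" if "T \<in> ?P" "T' \<in> ?P" for T T'
    using that L_subset by (intro level_weight_chain[OF finite_V]) auto
  have supp: "{v. x v \<noteq> 0} \<in> L" using x by (simp add: realization_set_def)
  have sub: "{v. retr x v \<noteq> 0} \<subseteq> S \<union> u ` C"
    unfolding S_def C_def by (auto elim!: retr_nonzeroE)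
  have S: "S \<in> K \<or> S = {}"
  proof (cases "?P \<inter> K = {}")
    case False
    \<comment> \<open>In a chain the union of two members is one of them, so a finite nonempty chain
      contains its union.\<close>
    have "\<Union>(?P \<inter> K) \<in> ?P \<inter> K"
    proof (rule finite_Sup_in)
      fix T T' assume "T \<in> ?P \<inter> K" "T' \<in> ?P \<inter> K"
      then show "T \<union> T' \<in> ?P \<inter> K"
        using chain[of T T'] by (auto simp: Un_absorb1 Un_absorb2)
    qed (use finite_L False in auto)
    then show ?thesis by (simp add: S_def)
  qed (simp add: S_def)
  have ST: "S \<subseteq> T" if "T \<in> C" for T
    unfolding S_def
  proof (rule Union_least)
    fix T' assume T': "T' \<in> ?P \<inter> K"
    \<comment> \<open>\<open>T\<close> is outside \<open>K\<close>, which is closed under nonempty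
      subsets, so in the chain it must lie above \<open>T'\<close>.\<close>
    have "\<not> T \<subseteq> T'" using that T' K_down[of T' T] L_nonempty by (auto simp: C_def)
    then show "T' \<subseteq> T" using chain[of T T'] that T' by (auto simp: C_def)
  qed
  \<comment> \<open>Total mass 1 rules out an empty support, which is not a simplex.\<close>
  have "(\<Sum>v\<in>V. retr x v) \<noteq> 0" using sum_retr[OF x] by simp
  then obtain v where "retr x v \<noteq> 0" using sum.not_neutral_contains_not_neutral by force
  then have ne: "{v. retr x v \<noteq> 0} \<noteq> {}" by blast
  have "S \<union> u ` C \<in> K"
  proof (rule chain_K)
    show "C \<subseteq> L - K" by (auto simp: C_def)
    show "T \<subseteq> T' \<or> T' \<subseteq> T" if "T \<in> C" "T' \<in> C" for T T'
      using chain that by (auto simp: C_def)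
    show "S \<union> u ` C \<noteq> {}" using sub ne by blast
  qed (use S ST in auto)
  then show "{v. retr x v \<noteq> 0} \<in> K" using sub ne by (rule K_down)
  have "{v. x v \<noteq> 0} \<union> u ` C \<in> L"
    using level_weight_subset_support by (intro below_L[OF supp]) (auto simp: C_def)
  moreover have "S \<subseteq> {v. x v \<noteq> 0}"
    unfolding S_def using level_weight_subset_support by blast
  ultimately show "{v. x v \<noteq> 0} \<union> {v. retr x v \<noteq> 0} \<in> L"
    using sub ne by (elim L_down) auto
qed

lemma retr_in_realization:
  assumes x: "x \<in> realization_set L"
  shows "retr x \<in> realization_set K"
proof -
  have "{v. retr x v \<noteq> 0} \<subseteq> V" using retr_support(1)[OF x] K_subset_L L_subset by blast
  then have "(\<Sum>v\<in>V. retr x v) = (\<Sum>v | retr x v \<noteq> 0. retr x v)"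
    using finite_V by (intro sum.mono_neutral_right) auto
  then show ?thesis
    using retr_support(1)[OF x] retr_nonneg sum_retr[OF x] by (simp add: realization_set_def)
qed

text \<open>The support of a point of the segment lies in the union of the supports of its ends, a
  simplex of \<open>L\<close>.\<close>

lemma segment_in_realization:
  assumes x: "x \<in> realization_set L" and t: "0 \<le> t" "t \<le> 1"
  shows "(\<lambda>v. (1 - t) * retr x v + t * x v) \<in> realization_set L"
proof -
  let ?y = "\<lambda>v. (1 - t) * retr x v + t * x v"
  have nn: "0 \<le> ?y v" for v
    using x t retr_nonneg[of x v] by (simp add: realization_set_def)
  have "(\<Sum>v\<in>V. ?y v) = 1"
    by (simp add: sum.distrib sum_retr[OF x] realization_sum_V[OF x] flip: sum_distrib_left)
  moreover have ne: "{v. ?y v \<noteq> 0} \<noteq> {}"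
  proof
    assume "{v. ?y v \<noteq> 0} = {}"
    then have "(\<Sum>v\<in>V. ?y v) = 0" by (intro sum.neutral) auto
    then show False using calculation by simp
  qed
  moreover have "{v. ?y v \<noteq> 0} \<in> L"
    by (rule L_down[OF retr_support(2)[OF x] _ ne]) auto
  moreover have "(\<Sum>v\<in>V. ?y v) = (\<Sum>v | ?y v \<noteq> 0. ?y v)"
    using finite_V L_subset[OF calculation(3)] by (intro sum.mono_neutral_right) auto
  ultimately show ?thesis using nn by (simp add: realization_set_def)
qed

lemma continuous_on_retr: "continuous_on A retr"
  unfolding retr_def
  using L_subset L_nonempty finite_V
  by (intro continuous_on_coordinatewise_then_product continuous_intros continuous_on_level_weight) auto

lemma homotopy_equivalence_inclusion:
  "homotopy_equivalence_map (geometric_realization K) (geometric_realization L) (\<lambda>x. x)"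
  unfolding homotopy_equivalence_map_def geometric_realization_def
proof (intro conjI exI[of _ retr])
  let ?K = "realization_set K" and ?L = "realization_set L"
  show "continuous_map (top_of_set ?K) (top_of_set ?L) (\<lambda>x. x)"
    using K_subset_L by (auto simp: realization_set_def)
  show c: "continuous_map (top_of_set ?L) (top_of_set ?K) retr"
    using retr_in_realization continuous_on_retr by auto
  show "homotopic_with (\<lambda>_. True) (top_of_set ?K) (top_of_set ?K) (retr \<circ> (\<lambda>x. x)) id"
    using retr_eq continuous_on_retr by (intro homotopic_with_equal) auto
  \<comment> \<open>At time 0 this is \<open>retr\<close>, at time 1 the identity.\<close>
  let ?h = "\<lambda>(t::real, x) v. (1 - t) * retr x v + t * x v"
  have "continuous_on ({0..1} \<times> ?L) ?h"
  proof -
    have "continuous_on ({0..1} \<times> ?L) (retr \<circ> snd)"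
      by (intro continuous_on_compose continuous_on_snd continuous_on_id continuous_on_retr)
    from continuous_on_product_then_coordinatewise[OF this]
    have 1: "continuous_on ({0..1::real} \<times> ?L) (\<lambda>p. retr (snd p) v)" for v
      by (simp add: o_def)
    have 2: "continuous_on ({0..1::real} \<times> ?L) (\<lambda>p. snd p v)" for v
      by (rule continuous_on_product_then_coordinatewise[OF continuous_on_snd[OF continuous_on_id]])
    have "continuous_on ({0..1} \<times> ?L) (\<lambda>p. (1 - fst p) * retr (snd p) v + fst p * snd p v)" for v
      by (intro continuous_on_add continuous_on_mult continuous_on_diff continuous_on_const
          continuous_on_fst continuous_on_id 1 2)
    then show ?thesis
      unfolding case_prod_unfold by (rule continuous_on_coordinatewise_then_product)
  qed
  then have "continuous_map (prod_topology (top_of_set {0..1}) (top_of_set ?L)) (top_of_set ?L) ?h"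
    using segment_in_realization
    by (auto simp flip: subtopology_Times)
  then show "homotopic_with (\<lambda>_. True) (top_of_set ?L) (top_of_set ?L) ((\<lambda>x. x) \<circ> retr) id"
    unfolding homotopic_with_def by (intro exI[of _ ?h]) auto
qed

end

section \<open>Closed neighbourhoods and the square of a graph\<close>

text \<open>Two members of a closed neighbourhood are joined by a walk of length at most 2 through
  its centre.\<close>

lemma square_adjI:
  assumes "pair_graph G" "w \<in> pverts G" "x \<in> closed_nbhd G w" "y \<in> closed_nbhd G w" "x \<noteq> y"
  shows "(x, y) \<in> parcs (graph_power G 2)"
proof -
  interpret pair_graph G by fact
  have V: "x \<in> pverts G" "y \<in> pverts G"
    using assms by (auto simp: closed_nbhd_def dest: in_arcsD2)
  consider "x = w" "(w, y) \<in> parcs G" | "y = w" "(x, w) \<in> parcs G" | "(x, w) \<in> parcs G" "(w, y) \<in> parcs G"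
    using assms by (auto simp: closed_nbhd_def intro: arcs_symmetric)
  then have "\<exists>p. awalk x p y \<and> length p \<le> 2"
  proof cases
    case 1
    then show ?thesis using V by (intro exI[of _ "[(x, y)]"]) (simp add: awalk_def)
  next
    case 2
    then show ?thesis using V by (intro exI[of _ "[(x, y)]"]) (simp add: awalk_def)
  next
    case 3
    then show ?thesis using V assms(2) by (intro exI[of _ "[(x, w), (w, y)]"]) (simp add: awalk_def)
  qed
  then have "graph_dist G x y \<le> ereal (real 2)"
    using graph_dist_le_iff[OF assms(1)] by blast
  then show ?thesis using V assms(5) by (simp add: graph_power_def)
qed

lemma cliqueI:
  "S \<noteq> {} \<Longrightarrow> S \<subseteq> pverts G \<Longrightarrow>
   (\<And>v w. v \<in> S \<Longrightarrow> w \<in> S \<Longrightarrow> v \<noteq> w \<Longrightarrow> (v, w) \<in> parcs G) \<Longrightarrow> clique G S"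
  by (simp add: clique_def)

lemma clique_subset: "clique G S \<Longrightarrow> T \<subseteq> S \<Longrightarrow> T \<noteq> {} \<Longrightarrow> clique G T"
  by (simp add: clique_def subset_iff)

text \<open>The polarity of the reflexive symmetric relation "equal or adjacent"; applied twice it
  is a closure operator on sets of vertices.\<close>

definition common_closed_nbrs :: "'a pair_pre_digraph \<Rightarrow> 'a set \<Rightarrow> 'a set" where
  "common_closed_nbrs G S = {w \<in> pverts G. S \<subseteq> closed_nbhd G w}"

theorem theorem3p1:
  fixes G :: "'a pair_pre_digraph"
  assumes "pair_graph G"
    and "\<And>S. clique (graph_power G 2) S \<Longrightarrow> \<exists>v\<in>pverts G. S \<subseteq> closed_nbhd G v"
  shows "homotopy_equivalence_map
           (geometric_realization (clique_complex G))
           (geometric_realization (clique_complex (graph_power G 2)))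
           (\<lambda>x. x)"
proof -
  interpret pair_graph G by fact
  let ?V = "pverts G" and ?K = "clique_complex G" and ?L = "clique_complex (graph_power G 2)"
  let ?N = "closed_nbhd G" and ?C = "common_closed_nbrs G"
  have LV: "S \<subseteq> ?V" "S \<noteq> {}" if "S \<in> ?L" for S
    using that by (auto simp: clique_complex_def clique_def graph_power_def)
  have sym: "v \<in> ?N w \<longleftrightarrow> w \<in> ?N v" for v w
    by (auto simp: closed_nbhd_def intro: arcs_symmetric)
  have C_sym: "S \<subseteq> ?C T \<Longrightarrow> T \<subseteq> ?V \<Longrightarrow> T \<subseteq> ?C S" for S T
    unfolding common_closed_nbrs_def using sym by blast
  have C_anti: "S \<subseteq> T \<Longrightarrow> ?C T \<subseteq> ?C S" for S T
    by (auto simp: common_closed_nbrs_def)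
  have C_ne: "?C S \<noteq> {}" if "S \<in> ?L" for S
    using assms(2)[of S] that by (auto simp: clique_complex_def common_closed_nbrs_def)
  have C_sub: "?C S \<subseteq> ?V" for S by (auto simp: common_closed_nbrs_def)
  have nbrs: "v \<in> ?N w" "w \<in> ?V" if "v \<in> S" "w \<in> ?C S" for v w S
    using that by (auto simp: common_closed_nbrs_def)
  \<comment> \<open>Any \<open>w\<close> in \<open>?C S\<close> has all of \<open>?C (?C S)\<close>
    in its closed neighbourhood.\<close>
  have CC_L: "T \<in> ?L" if S: "S \<in> ?L" and T: "T \<subseteq> ?C (?C S)" "T \<noteq> {}" for S T
  proof -
    obtain w where w: "w \<in> ?C S" using C_ne[OF S] by blast
    then have "(x, y) \<in> parcs (graph_power G 2)" if "x \<in> T" "y \<in> T" "x \<noteq> y" for x y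
      using that T sym nbrs[OF w] C_sub[of S] by (intro square_adjI[OF assms(1), of w]) auto
    then show ?thesis using T C_sub
      by (auto simp: clique_complex_def clique_def graph_power_def common_closed_nbrs_def)
  qed
  have "\<exists>a\<in>?C (?C S). ?C (?C S) \<subseteq> ?N a" if S: "S \<in> ?L" for S
  proof -
    let ?T = "?C S \<union> ?C (?C S)"
    \<comment> \<open>Members of \<open>?C S\<close> share a neighbour \<open>s\<close> in
      \<open>S\<close>, members of \<open>?C (?C S)\<close> share \<open>w\<close> in
      \<open>?C S\<close>, and a mixed pair is equal or adjacent in \<open>G\<close>.\<close>
    have adj: "(x, y) \<in> parcs (graph_power G 2)" if xy: "x \<in> ?T" "y \<in> ?T" "x \<noteq> y" for x y
    proof -
      obtain s where s: "s \<in> S" using LV[OF S] by blast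
      obtain w where w: "w \<in> ?C S" using C_ne[OF S] by blast
      have sC: "x \<in> ?N s" "s \<in> ?V" if "x \<in> ?C S" for x
        using nbrs(1)[OF s that] sym[of x s] LV[OF S] s by auto
      have wC: "x \<in> ?N w" "w \<in> ?V" if "x \<in> ?C (?C S)" for x
        using nbrs(1)[OF w that] sym[of x w] C_sub w by auto
      consider "x \<in> ?C S" "y \<in> ?C S" | "x \<in> ?C (?C S)" "y \<in> ?C (?C S)"
        | "x \<in> ?C S" "y \<in> ?C (?C S)" | "y \<in> ?C S" "x \<in> ?C (?C S)"
        using xy by blast
      then show ?thesis
      proof cases
        case 1
        then show ?thesis using sC xy by (intro square_adjI[OF assms(1), of s]) auto
      next
        case 2
        then show ?thesis using wC xy by (intro square_adjI[OF assms(1), of w]) auto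
      next
        case 3
        then show ?thesis using nbrs xy by (intro square_adjI[OF assms(1), of y]) (auto simp: closed_nbhd_def)
      next
        case 4
        then show ?thesis using nbrs xy by (intro square_adjI[OF assms(1), of x]) (auto simp: closed_nbhd_def)
      qed
    qed
    then have "clique (graph_power G 2) ?T"
      using C_ne[OF S] C_sub by (auto simp: clique_def graph_power_def common_closed_nbrs_def)
    then obtain a where "a \<in> ?V" "?T \<subseteq> ?N a" using assms(2) by blast
    \<comment> \<open>Since \<open>?N a\<close> contains \<open>?C S\<close>, the vertex
      \<open>a\<close> itself lies in \<open>?C (?C S)\<close>.\<close>
    then show ?thesis by (intro bexI[of _ a]) (auto simp: common_closed_nbrs_def)
  qed
  then obtain u where u: "\<And>S. S \<in> ?L \<Longrightarrow> u S \<in> ?C (?C S)" "\<And>S. S \<in> ?L \<Longrightarrow> ?C (?C S) \<subseteq> ?N (u S)"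
    by metis
  have CC: "S \<subseteq> ?C (?C S)" if "S \<subseteq> ?V" for S
    using C_sym[of "?C S" S] that by blast
  have uCC: "u T \<in> ?C (?C S)" if "T \<subseteq> S" "T \<in> ?L" for S T
    using C_anti[OF C_anti[OF that(1)]] u(1)[OF that(2)] by blast
  interpret retractable_pair ?V ?K ?L u
  proof
    fix S T assume "S \<in> ?K" "T \<subseteq> S" "T \<noteq> {}"
    then show "T \<in> ?K" by (auto simp: clique_complex_def intro: clique_subset)
  next
    fix S T assume "S \<in> ?L" "T \<subseteq> S" "T \<noteq> {}"
    then show "T \<in> ?L" by (auto simp: clique_complex_def intro: clique_subset)
  next
    fix S C assume S: "S \<in> ?L" and C: "C \<subseteq> ?L - ?K" "\<And>T. T \<in> C \<Longrightarrow> T \<subseteq> S"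
    show "S \<union> u ` C \<in> ?L"
      proof (rule CC_L[OF S])
      show "S \<union> u ` C \<subseteq> ?C (?C S)" using CC[OF LV(1)[OF S]] uCC C by auto
    qed (use LV[OF S] in auto)
  next
    fix S C
    assume C: "C \<subseteq> ?L - ?K" "\<And>T T'. T \<in> C \<Longrightarrow> T' \<in> C \<Longrightarrow> T \<subseteq> T' \<or> T' \<subseteq> T"
      and S: "S \<in> ?K \<or> S = {}" "\<And>T. T \<in> C \<Longrightarrow> S \<subseteq> T" and ne: "S \<union> u ` C \<noteq> {}"
    \<comment> \<open>Here \<open>S\<close> is contained in \<open>T\<close>, \<open>T\<close> in
      its closure, and that closure in \<open>?N (u T)\<close>.\<close>
    have Su: "v \<in> ?N (u T)" if "v \<in> S" "T \<in> C" for v T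
      using that S(2)[of T] CC[of T] LV[of T] u(2)[of T] C(1) by blast
    have Su': "u T \<in> ?N v" if "v \<in> S" "T \<in> C" for v T
      using Su[OF that] sym by simp
    \<comment> \<open>For nested simplices the closure of the larger contains both chosen vertices,
      and the vertex of the larger one is its cone point.\<close>
    have uu: "u T \<in> ?N (u T')" if T: "T \<in> C" "T' \<in> C" for T T'
      using C(2)[OF T]
    proof
      assume "T \<subseteq> T'"
      then show ?thesis using uCC[of T T'] u(2)[of T'] C(1) T by auto
    next
      assume "T' \<subseteq> T"
      then show ?thesis using uCC[of T' T] u(2)[of T] C(1) T sym[of "u T" "u T'"] by auto
    qed
    have SS: "v \<in> ?N w" if "v \<in> S" "w \<in> S" for v w
      using that S(1) by (auto simp: clique_complex_def clique_def closed_nbhd_def)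
    have nbr: "v \<in> ?N w" if "v \<in> S \<union> u ` C" "w \<in> S \<union> u ` C" for v w
      using that SS Su Su' uu by auto
    have "clique G (S \<union> u ` C)"
    proof (rule cliqueI)
      have "S \<subseteq> ?V" using S(1) by (auto simp: clique_complex_def clique_def)
      moreover have "u ` C \<subseteq> ?V" using u(1) C(1) C_sub by blast
      ultimately show "S \<union> u ` C \<subseteq> ?V" by simp
    next
      fix v w assume "v \<in> S \<union> u ` C" "w \<in> S \<union> u ` C" "v \<noteq> w"
      then show "(v, w) \<in> parcs G" using nbr[of w v] by (simp add: closed_nbhd_def)
    qed (rule ne)
    then show "S \<union> u ` C \<in> ?K" by (simp add: clique_complex_def)
  qed (use LV pair_finite_verts clique_complex_subset_power[OF assms(1), of 2] in auto)
  show ?thesis by (rule homotopy_equivalence_inclusion)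
qed

end
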